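(* Consider instances of Fair Max-Min diversification with $n$ points, $m$ groups, parameters $k_1,\dots,k_m$, $k=\sum_i k_i$ and optimal diversity $\ell^*$, whose points arrive one by one in a stream, where a lower bound on the minimum and an upper bound on the maximum pairwise distance are given, with ratio $\mathrm{poly}(n)$. Let $\epsilon\in(0,1)$. (1) For general metrics, there is a single-pass data stream algorithm using $O(\epsilon^{-1}km\log n)$ space that returns a $30(1+\epsilon)$-approximation with $(1-\epsilon)$-fairness, i.e. a set $\mathcal{S}\subseteq\mathcal{X}$ with $\mathrm{div}(\mathcal{S})\ge\ell^*/(30(1+\epsilon))$ and $|\mathcal{S}\cap\mathcal{X}_i|\ge(1-\epsilon)k_i$ for all $i\in[m]$. (2) For Euclidean metrics, there is a single-pass data stream algorithm using $O((8/\epsilon)^\lambda km\,\epsilon^{-1}\log n)$ space that returns a $(1+\epsilon)$-approximation with $(1-\epsilon)$-fairness, i.e. a set $\mathcal{S}\subseteq\mathcal{X}$ with $\mathrm{div}(\mathcal{S})\ge\ell^*/(1+\epsilon)$ and $|\mathcal{S}\cap\mathcal{X}_i|\ge(1-\epsilon)k_i$ for all $i\in[m]$, where $\lambda$ is the doubling dimension of $\mathcal{X}\subset\mathbb{R}^D$.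
   Context: Fair Max-Min diversification: the input is a metric space $(\mathcal{X},d)$ with $|\mathcal{X}|=n$, where $\mathcal{X}=\bigcup_{i=1}^m\mathcal{X}_i$ is partitioned into $m$ disjoint groups, and non-negative integers $k_1,\dots,k_m$ with $k_i\le|\mathcal{X}_i|$. For $\mathcal{S}\subseteq\mathcal{X}$ let $\mathrm{div}(\mathcal{S})=\min_{u,v\in\mathcal{S},u\ne v}d(u,v)$. The optimal diversity is $\ell^*=\max\{\mathrm{div}(\mathcal{S}):\mathcal{S}\subseteq\mathcal{X},\ |\mathcal{S}\cap\mathcal{X}_i|=k_i\ \forall i\in[m]\}$. Doubling dimension: write $\mathbf{B}(p,r)=\{q\in\mathcal{X}: d(p,q)<r\}$. The doubling dimension of $\mathcal{X}$ is the smallest integer $\lambda$ such that any ball $\mathbf{B}(p,r)$ of radius $r$ around a point $p\in\mathcal{X}$ can be covered using at most $(r/r')^\lambda$ balls of radius $r'$. Streaming: points are revealed one at a time (with their group), in one pass; space is measured in the number of stored points.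
   Formalization: The doubling dimension is taken with the covering condition only for r' ≤ r/2, since for unrestricted r' no finite space with at least two points has one; in (2) the algorithm is given λ as a parameter. *)

theory Defs
  imports "HOL-Analysis.Analysis"
begin

section \<open>Fair Max-Min diversification\<close>

text \<open>The partition of \<open>X\<close> into the groups \<open>1, \<dots>, m\<close> is given by a labelling \<open>g\<close>.\<close>

definition group :: "'a set \<Rightarrow> ('a \<Rightarrow> nat) \<Rightarrow> nat \<Rightarrow> 'a set" where
  "group X g i = {x \<in> X. g x = i}"

definition fmmd_instance ::
  "'a set \<Rightarrow> ('a \<Rightarrow> 'a \<Rightarrow> real) \<Rightarrow> ('a \<Rightarrow> nat) \<Rightarrow> nat \<Rightarrow> (nat \<Rightarrow> nat) \<Rightarrow> bool" where
  "fmmd_instance X d g m ks \<longleftrightarrow>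
     finite X \<and> Metric_space X d \<and> g ` X \<subseteq> {1..m} \<and>
     (\<forall>i\<in>{1..m}. ks i \<le> card (group X g i))"

text \<open>Extended reals give the minimum over the empty set, which arises for
  \<open>card S \<le> 1\<close>, the value \<open>\<infinity>\<close>.\<close>

definition diversity :: "('a \<Rightarrow> 'a \<Rightarrow> real) \<Rightarrow> 'a set \<Rightarrow> ereal" where
  "diversity d S = (INF (u, v) \<in> {(u, v). u \<in> S \<and> v \<in> S \<and> u \<noteq> v}. ereal (d u v))"

definition opt_diversity ::
  "'a set \<Rightarrow> ('a \<Rightarrow> 'a \<Rightarrow> real) \<Rightarrow> ('a \<Rightarrow> nat) \<Rightarrow> nat \<Rightarrow> (nat \<Rightarrow> nat) \<Rightarrow> ereal" where
  "opt_diversity X d g m ks =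
     (SUP S \<in> {S. S \<subseteq> X \<and> (\<forall>i\<in>{1..m}. card (S \<inter> group X g i) = ks i)}. diversity d S)"

definition approx_fair_solution ::
  "'a set \<Rightarrow> ('a \<Rightarrow> 'a \<Rightarrow> real) \<Rightarrow> ('a \<Rightarrow> nat) \<Rightarrow> nat \<Rightarrow> (nat \<Rightarrow> nat) \<Rightarrow>
   real \<Rightarrow> real \<Rightarrow> 'a set \<Rightarrow> bool" where
  "approx_fair_solution X d g m ks \<alpha> \<epsilon> S \<longleftrightarrow>
     S \<subseteq> X \<and>
     diversity d S \<ge> opt_diversity X d g m ks / ereal \<alpha> \<and>
     (\<forall>i\<in>{1..m}. real (card (S \<inter> group X g i)) \<ge> (1 - \<epsilon>) * real (ks i))"


section \<open>Doubling dimension\<close>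

text \<open>All balls are open balls of the space \<open>X\<close> itself, centred at points of \<open>X\<close>.  Radii are
  compared for \<open>r' \<le> r / 2\<close> only.  Admitting every \<open>r' \<le> r\<close> would leave no finite space with two
  or more points a doubling dimension: for a pair \<open>p, q\<close> at the least distance \<open>\<delta>\<close>, take
  \<open>r' = \<delta>\<close> and let \<open>r\<close> decrease to \<open>\<delta>\<close>; the ball of radius \<open>r\<close> around \<open>p\<close> then always needs at
  least two balls of radius \<open>r'\<close>, whereas \<open>(r / r') ^ l\<close> tends to \<open>1\<close>.\<close>

definition doubling_bound :: "'a set \<Rightarrow> ('a \<Rightarrow> 'a \<Rightarrow> real) \<Rightarrow> nat \<Rightarrow> bool" where
  "doubling_bound X d l \<longleftrightarrow>
     (\<forall>p\<in>X. \<forall>r r'. 0 < r' \<and> r' \<le> r / 2 \<longrightarrow>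
        (\<exists>Q \<subseteq> X. finite Q \<and> real (card Q) \<le> (r / r') ^ l \<and>
           Metric_space.mball X d p r \<subseteq> (\<Union>q\<in>Q. Metric_space.mball X d q r')))"

definition doubling_dim :: "'a set \<Rightarrow> ('a \<Rightarrow> 'a \<Rightarrow> real) \<Rightarrow> nat" where
  "doubling_dim X d = (LEAST l. doubling_bound X d l)"

lemma doubling_bound_card:
  assumes "Metric_space X d" "finite X"
  shows "doubling_bound X d (card X)"
  unfolding doubling_bound_def
proof (intro ballI allI impI)
  fix p r r'
  assume "p \<in> X" and r: "0 < r' \<and> r' \<le> r / (2::real)"
  interpret Metric_space X d by fact
  have "real (card X) \<le> 2 ^ card X"
    using of_nat_mono[OF less_imp_le[OF less_exp[of "card X"]], where 'a = real] by simp
  also have "\<dots> \<le> (r / r') ^ card X"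
    using r by (intro power_mono) (auto simp: field_simps)
  finally have "real (card X) \<le> (r / r') ^ card X" .
  moreover have "mball p r \<subseteq> (\<Union>q\<in>X. mball q r')"
    using r by auto
  ultimately show "\<exists>Q\<subseteq>X. finite Q \<and> real (card Q) \<le> (r / r') ^ card X \<and>
      mball p r \<subseteq> (\<Union>q\<in>Q. mball q r')"
    using assms(2) by blast
qed

lemma doubling_bound_doubling_dim:
  assumes "Metric_space X d" "finite X"
  shows "doubling_bound X d (doubling_dim X d)"
  unfolding doubling_dim_def using doubling_bound_card[OF assms] by (rule LeastI)


section \<open>Euclidean space of arbitrary dimension\<close>

text \<open>A point of the \<open>D\<close>-dimensional space is a sequence vanishing from index \<open>D\<close> on, as in
  \<^const>\<open>Euclidean_space\<close>; thus \<open>D\<close> can be quantified after the constants of the bounds.\<close>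

definition euclid_dist :: "nat \<Rightarrow> (nat \<Rightarrow> real) \<Rightarrow> (nat \<Rightarrow> real) \<Rightarrow> real" where
  "euclid_dist D x y = L2_set (\<lambda>i. x i - y i) {..<D}"


section \<open>Single-pass streaming algorithms\<close>

text \<open>The memory is a list of points that have arrived, and nothing else.  When a point
  arrives, the algorithm decides which of the stored points and the new one to keep; all other
  points are lost.  The decision, and the final answer, depend only on the groups of and the
  pairwise distances between the points at hand.  They are referred to by their positions in the
  memory, so that neither their identity nor the distances to other points can be exploited.\<close>

type_synonym view = "(nat \<times> real list) list"

definition view :: "('a \<Rightarrow> 'a \<Rightarrow> real) \<Rightarrow> ('a \<Rightarrow> nat) \<Rightarrow> 'a list \<Rightarrow> view" where
  "view d g ps = map (\<lambda>p. (g p, map (d p) ps)) ps"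

record stream_alg =
  keep :: "view \<Rightarrow> nat set"
  answer :: "view \<Rightarrow> nat set"

definition step ::
  "stream_alg \<Rightarrow> ('a \<Rightarrow> 'a \<Rightarrow> real) \<Rightarrow> ('a \<Rightarrow> nat) \<Rightarrow> 'a list \<Rightarrow> 'a \<Rightarrow> 'a list" where
  "step A d g mem p = nths (mem @ [p]) (keep A (view d g (mem @ [p])))"

definition memory ::
  "stream_alg \<Rightarrow> ('a \<Rightarrow> 'a \<Rightarrow> real) \<Rightarrow> ('a \<Rightarrow> nat) \<Rightarrow> 'a list \<Rightarrow> 'a list" where
  "memory A d g xs = foldl (step A d g) [] xs"

definition result ::
  "stream_alg \<Rightarrow> ('a \<Rightarrow> 'a \<Rightarrow> real) \<Rightarrow> ('a \<Rightarrow> nat) \<Rightarrow> 'a list \<Rightarrow> 'a set" where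
  "result A d g xs =
     (let mem = memory A d g xs in set (nths mem (answer A (view d g mem))))"

definition space_used ::
  "stream_alg \<Rightarrow> ('a \<Rightarrow> 'a \<Rightarrow> real) \<Rightarrow> ('a \<Rightarrow> nat) \<Rightarrow> 'a list \<Rightarrow> nat" where
  "space_used A d g xs = (MAX t\<in>{..length xs}. length (memory A d g (take t xs)))"

text \<open>\<open>xs\<close> is the order of arrival, \<open>lo\<close> and \<open>hi\<close> are the given bounds on the pairwise
  distances, and their ratio is at most \<open>n ^ c\<close> for the number \<open>n\<close> of points.  Minimum and
  maximum pairwise distance presuppose \<open>n \<ge> 2\<close>.\<close>

definition stream_of_instance ::
  "'a list \<Rightarrow> 'a set \<Rightarrow> ('a \<Rightarrow> 'a \<Rightarrow> real) \<Rightarrow> ('a \<Rightarrow> nat) \<Rightarrow> nat \<Rightarrow> (nat \<Rightarrow> nat) \<Rightarrow>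
   real \<Rightarrow> real \<Rightarrow> nat \<Rightarrow> bool" where
  "stream_of_instance xs X d g m ks lo hi c \<longleftrightarrow>
     fmmd_instance X d g m ks \<and> distinct xs \<and> set xs = X \<and> 2 \<le> card X \<and>
     0 < lo \<and> (\<forall>u\<in>X. \<forall>v\<in>X. u \<noteq> v \<longrightarrow> lo \<le> d u v \<and> d u v \<le> hi) \<and>
     hi / lo \<le> real (card X) ^ c"

end

theory Submission
  imports Defs
begin

text \<open>For every scale \<open>\<gamma>\<close> in a geometric progression and every group, the memory holds a greedily
  chosen \<open>\<gamma>\<close>-separated set, capped at \<open>N k\<close> points, where \<open>N\<close> bounds the number of \<open>\<gamma>\<close>-separated
  points in an open ball of the target radius \<open>r\<close>.  Choose \<open>\<gamma>\<close> proportional to the optimum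
  \<open>\<ell>\<close>.  A group whose greedy set stays below the cap is covered by it, so that the points of an
  optimal solution in this group can be moved by less than \<open>\<gamma>\<close> into the memory; moved points keep
  distance \<open>\<ell> - 2 \<gamma> \<ge> r\<close>.  From the other groups points are added one at a time: fewer than \<open>k\<close>
  chosen points exclude at most \<open>N\<close> points each, so that the cap \<open>N k\<close> leaves a free one.  Hence
  the memory contains an exactly fair solution of diversity \<open>r\<close>, and returning a best fair subset of
  the memory suffices.  In general metrics \<open>N = 1\<close> works for \<open>r \<le> \<gamma> / 2\<close>; for \<open>r = \<ell> / (1 + \<epsilon>)\<close>
  the doubling dimension gives \<open>N \<le> (8 / \<epsilon>) ^ \<lambda>\<close>.\<close>

section \<open>Separated sets and packing in small balls\<close>

definition separated :: "('a \<Rightarrow> 'a \<Rightarrow> real) \<Rightarrow> real \<Rightarrow> 'a set \<Rightarrow> bool" where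
  "separated d r S \<longleftrightarrow> (\<forall>u\<in>S. \<forall>v\<in>S. u \<noteq> v \<longrightarrow> r \<le> d u v)"

text \<open>Trades the extended-real infimum for a condition on pairs, the form in which real radii
  are handled below; for at most one point both sides hold vacuously.\<close>

lemma le_diversity_iff: "ereal r \<le> diversity d S \<longleftrightarrow> separated d r S"
  unfolding diversity_def separated_def by (auto simp: le_INF_iff)

text \<open>Two distinct points of \<open>T\<close> in this ball would, by the triangle inequality
  through \<open>q\<close>, be closer than \<gamma>. It gives the packing constant 1 in general
  metrics and is applied to each covering ball in the doubling case.\<close>

lemma separated_ball_card_le_1:
  assumes "Metric_space X d" "q \<in> X" "T \<subseteq> X" "separated d \<gamma> T"
  shows "card {t \<in> T. d q t < \<gamma> / 2} \<le> 1"
proof -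
  interpret Metric_space X d by fact
  have "s = t" if "s \<in> T" "t \<in> T" "d q s < \<gamma> / 2" "d q t < \<gamma> / 2" for s t
  proof (rule ccontr)
    assume "s \<noteq> t"
    then have "\<gamma> \<le> d s t"
      using that assms(4) unfolding separated_def by blast
    also have "\<dots> \<le> d q s + d q t"
      using triangle[of s q t] commute[of s q] that assms(2,3) by auto
    finally show False using that by simp
  qed
  \<comment> \<open>In the infinite case the bound holds by the default value 0 of
    \<open>card\<close>.\<close>
  then show ?thesis
    by (cases "finite {t \<in> T. d q t < \<gamma> / 2}") (auto simp: card_le_Suc0_iff_eq)
qed

section \<open>Greedy separated sets\<close>

definition greedy_step ::
  "('a \<Rightarrow> 'a \<Rightarrow> real) \<Rightarrow> ('a \<Rightarrow> nat) \<Rightarrow> real \<Rightarrow> nat \<Rightarrow> nat \<Rightarrow> 'a set \<Rightarrow> 'a \<Rightarrow> 'a set" where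
  "greedy_step d g \<gamma> i K T p =
     (if g p = i \<and> card T < K \<and> (\<forall>q\<in>T. \<gamma> \<le> d p q) then insert p T else T)"

definition greedy ::
  "('a \<Rightarrow> 'a \<Rightarrow> real) \<Rightarrow> ('a \<Rightarrow> nat) \<Rightarrow> real \<Rightarrow> nat \<Rightarrow> nat \<Rightarrow> 'a list \<Rightarrow> 'a set" where
  "greedy d g \<gamma> i K xs = foldl (greedy_step d g \<gamma> i K) {} xs"

lemma greedy_Nil [simp]: "greedy d g \<gamma> i K [] = {}"
  by (simp add: greedy_def)

lemma greedy_snoc:
  "greedy d g \<gamma> i K (xs @ [x]) = greedy_step d g \<gamma> i K (greedy d g \<gamma> i K xs) x"
  by (simp add: greedy_def)

lemma greedy_step_bounds:
  "T \<subseteq> greedy_step d g \<gamma> i K T p" "greedy_step d g \<gamma> i K T p \<subseteq> insert p T"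
  by (auto simp: greedy_step_def)

lemma greedy_subset: "greedy d g \<gamma> i K xs \<subseteq> {x \<in> set xs. g x = i}"
  by (induction xs rule: rev_induct) (auto simp: greedy_snoc greedy_step_def)

lemma finite_greedy [simp]: "finite (greedy d g \<gamma> i K xs)"
  by (rule finite_subset[OF greedy_subset]) simp

lemma card_greedy: "card (greedy d g \<gamma> i K xs) \<le> K"
  by (induction xs rule: rev_induct) (auto simp: greedy_snoc greedy_step_def card_insert_if)

lemma separated_greedy:
  assumes "\<And>x y. d x y = d y x"
  shows "separated d \<gamma> (greedy d g \<gamma> i K xs)"
proof (induction xs rule: rev_induct)
  case (snoc x xs)
  then show ?case
    using assms by (auto simp: greedy_snoc greedy_step_def separated_def)
qed (simp add: separated_def)

text \<open>The greedy set only grows, so being below the cap at the end means never having been at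
  the cap. A point of group \<open>i\<close> is then rejected only because of a chosen point closer
  than \<gamma>; if it is accepted, it is its own witness by
  \<open>d x x < \<gamma>\<close>.\<close>

lemma greedy_maximal:
  assumes "card (greedy d g \<gamma> i K xs) < K" "x \<in> set xs" "g x = i" "d x x < \<gamma>"
  shows "\<exists>q \<in> greedy d g \<gamma> i K xs. d x q < \<gamma>"
  using assms
proof (induction xs rule: rev_induct)
  case (snoc y xs)
  let ?T = "greedy d g \<gamma> i K xs"
  have mono: "?T \<subseteq> greedy d g \<gamma> i K (xs @ [y])"
    by (simp add: greedy_snoc greedy_step_bounds)
  have less: "card ?T < K"
    using card_mono[OF _ mono] snoc.prems(1) by simp
  show ?case
  proof (cases "x \<in> set xs")
    case True
    then show ?thesis using snoc.IH[OF less] snoc.prems mono by blast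
  next
    case False
    then have "x = y" using snoc.prems by simp
    then show ?thesis
      using less snoc.prems by (force simp: greedy_snoc greedy_step_def not_le)
  qed
qed simp

text \<open>The algorithm sees positions, the analysis speaks of points. Injectivity of the
  translation preserves the cardinality that is compared with the cap.\<close>

lemma greedy_map:
  assumes "inj_on f (set js)"
    and "\<And>j. j \<in> set js \<Longrightarrow> g' j = g (f j)"
    and "\<And>j j'. j \<in> set js \<Longrightarrow> j' \<in> set js \<Longrightarrow> d' j j' = d (f j) (f j')"
  shows "greedy d g \<gamma> i K (map f js) = f ` greedy d' g' \<gamma> i K js"
  using assms
proof (induction js rule: rev_induct)
  case (snoc j js)
  let ?T = "greedy d' g' \<gamma> i K js"
  have IH: "greedy d g \<gamma> i K (map f js) = f ` ?T"
    using snoc.prems by (intro snoc.IH) (auto simp: inj_on_def)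
  have sub: "?T \<subseteq> set js" using greedy_subset by fastforce
  then have "inj_on f ?T"
    using snoc.prems(1) by (auto simp: inj_on_def)
  then have "card (f ` ?T) = card ?T" by (rule card_image)
  moreover have "d' j q = d (f j) (f q)" if "q \<in> ?T" for q
    using that sub snoc.prems(3) by auto
  moreover have "g' j = g (f j)" using snoc.prems(2) by simp
  ultimately show ?case
    by (auto simp: greedy_snoc IH greedy_step_def)
qed simp

text \<open>Points that the greedy choice discards do not influence it.  Hence it can be replayed on
  the memory, and the algorithm needs no bookkeeping besides the stored points.\<close>

lemma greedy_filter:
  assumes "greedy d g \<gamma> i K xs \<subseteq> S"
  shows "greedy d g \<gamma> i K (filter (\<lambda>x. x \<in> S) xs) = greedy d g \<gamma> i K xs"
  using assms
proof (induction xs rule: rev_induct)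
  case (snoc x xs)
  let ?T = "greedy d g \<gamma> i K xs"
  have step: "?T \<subseteq> greedy d g \<gamma> i K (xs @ [x])" "greedy d g \<gamma> i K (xs @ [x]) \<subseteq> insert x ?T"
    by (simp_all add: greedy_snoc greedy_step_bounds)
  have IH: "greedy d g \<gamma> i K (filter (\<lambda>x. x \<in> S) xs) = ?T"
    using step(1) snoc.prems by (intro snoc.IH) blast
  show ?case
  proof (cases "x \<in> S")
    case True
    then show ?thesis by (simp add: greedy_snoc IH)
  next
    case False
    then have "greedy d g \<gamma> i K (xs @ [x]) = ?T" using step snoc.prems by blast
    then show ?thesis using False IH by simp
  qed
qed simp

section \<open>The coreset and the streaming algorithm\<close>

definition core ::
  "('a \<Rightarrow> 'a \<Rightarrow> real) \<Rightarrow> ('a \<Rightarrow> nat) \<Rightarrow> nat \<Rightarrow> nat \<Rightarrow> real set \<Rightarrow> 'a list \<Rightarrow> 'a set" where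
  "core d g m K \<Gamma> xs = (\<Union>\<gamma>\<in>\<Gamma>. \<Union>i\<in>{1..m}. greedy d g \<gamma> i K xs)"

definition feasible ::
  "'a set \<Rightarrow> ('a \<Rightarrow> nat) \<Rightarrow> nat \<Rightarrow> (nat \<Rightarrow> nat) \<Rightarrow> 'a set set" where
  "feasible X g m ks = {S. S \<subseteq> X \<and> (\<forall>i\<in>{1..m}. card (S \<inter> group X g i) = ks i)}"

text \<open>The model charges for stored points and not for computation, so the answer may be taken
  by choice from all optimal sets.\<close>

definition opt_solution ::
  "'a set \<Rightarrow> ('a \<Rightarrow> 'a \<Rightarrow> real) \<Rightarrow> ('a \<Rightarrow> nat) \<Rightarrow> nat \<Rightarrow> (nat \<Rightarrow> nat) \<Rightarrow> 'a set" where
  "opt_solution X d g m ks =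
     (SOME S. S \<in> feasible X g m ks \<and> diversity d S = opt_diversity X d g m ks)"

definition view_dist :: "view \<Rightarrow> nat \<Rightarrow> nat \<Rightarrow> real" where
  "view_dist v j j' = snd (v ! j) ! j'"

definition view_group :: "view \<Rightarrow> nat \<Rightarrow> nat" where
  "view_group v j = fst (v ! j)"

definition core_alg :: "nat \<Rightarrow> (nat \<Rightarrow> nat) \<Rightarrow> nat \<Rightarrow> real set \<Rightarrow> stream_alg" where
  "core_alg m ks K \<Gamma> =
     \<lparr>keep = (\<lambda>v. core (view_dist v) (view_group v) m K \<Gamma> [0..<length v]),
      answer = (\<lambda>v. opt_solution {..<length v} (view_dist v) (view_group v) m ks)\<rparr>"

lemma length_view [simp]: "length (view d g ps) = length ps"
  by (simp add: view_def)

lemma view_dist_view [simp]: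
  "j < length ps \<Longrightarrow> j' < length ps \<Longrightarrow> view_dist (view d g ps) j j' = d (ps ! j) (ps ! j')"
  by (simp add: view_dist_def view_def)

lemma view_group_view [simp]: "j < length ps \<Longrightarrow> view_group (view d g ps) j = g (ps ! j)"
  by (simp add: view_group_def view_def)

lemma core_subset: "core d g m K \<Gamma> xs \<subseteq> set xs"
  unfolding core_def using greedy_subset by fastforce

text \<open>A point outside the core can never return to it later, which makes it safe to
  forget.\<close>

lemma core_snoc_subset: "core d g m K \<Gamma> (xs @ [x]) \<subseteq> insert x (core d g m K \<Gamma> xs)"
  unfolding core_def greedy_snoc by (fastforce simp: greedy_step_def split: if_splits)

lemma core_filter:
  assumes "core d g m K \<Gamma> xs \<subseteq> S"
  shows "core d g m K \<Gamma> (filter (\<lambda>x. x \<in> S) xs) = core d g m K \<Gamma> xs"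
  unfolding core_def
proof (intro SUP_cong refl greedy_filter)
  show "greedy d g \<gamma> i K xs \<subseteq> S" if "\<gamma> \<in> \<Gamma>" "i \<in> {1..m}" for \<gamma> i
    using that assms unfolding core_def by blast
qed

lemma card_core:
  assumes "finite \<Gamma>"
  shows "card (core d g m K \<Gamma> xs) \<le> card \<Gamma> * (m * K)"
proof -
  have "card (\<Union>i\<in>{1..m}. greedy d g \<gamma> i K xs) \<le> m * K" for \<gamma>
    using card_UN_le[of "{1..m}" "\<lambda>i. greedy d g \<gamma> i K xs"]
      sum_bounded_above[of "{1..m}" "\<lambda>i. card (greedy d g \<gamma> i K xs)" K]
    by (auto simp: card_greedy intro: order_trans)
  then show ?thesis
    using card_UN_le[OF assms, of "\<lambda>\<gamma>. \<Union>i\<in>{1..m}. greedy d g \<gamma> i K xs"]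
      sum_bounded_above[of \<Gamma> "\<lambda>\<gamma>. card (\<Union>i\<in>{1..m}. greedy d g \<gamma> i K xs)" "m * K"]
    unfolding core_def by (auto intro: order_trans)
qed

lemma core_view:
  assumes "distinct ps"
  shows "(!) ps ` core (view_dist (view d g ps)) (view_group (view d g ps)) m K \<Gamma> [0..<length ps]
    = core d g m K \<Gamma> ps"
proof -
  have "greedy d g \<gamma> i K (map ((!) ps) [0..<length ps]) =
      (!) ps ` greedy (view_dist (view d g ps)) (view_group (view d g ps)) \<gamma> i K [0..<length ps]"
    for \<gamma> i
    using assms by (intro greedy_map) (auto simp: inj_on_nth)
  then show ?thesis
    unfolding core_def by (simp add: map_nth image_UN)
qed

text \<open>Indexing a distinct list is injective, so the positions kept are exactly those of core
  points, and selecting them is filtering by membership in the core.\<close>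

lemma step_core_alg:
  assumes "distinct (mem @ [p])"
  shows "step (core_alg m ks K \<Gamma>) d g mem p =
    filter (\<lambda>x. x \<in> core d g m K \<Gamma> (mem @ [p])) (mem @ [p])"
proof -
  define ps where "ps = mem @ [p]"
  define I where "I = core (view_dist (view d g ps)) (view_group (view d g ps)) m K \<Gamma> [0..<length ps]"
  have I: "I \<subseteq> {..<length ps}"
    using core_subset[of _ _ m K \<Gamma> "[0..<length ps]"] unfolding I_def by fastforce
  have img: "(!) ps ` I = core d g m K \<Gamma> ps"
    using core_view assms unfolding I_def ps_def by blast
  have "I = {j. j < length ps \<and> ps ! j \<in> core d g m K \<Gamma> ps}"
    using I assms unfolding img[symmetric] ps_def[symmetric]
    by (auto simp: nth_eq_iff_index_eq)
  then show ?thesis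
    unfolding filter_eq_nths step_def ps_def[symmetric] core_alg_def
    by (simp add: I_def)
qed

text \<open>The invariant of the pass: the memory is the core of the whole prefix, although only
  stored points are inspected. The memory with the new point is the prefix filtered by
  \<open>S\<close>, a superset of the next core, and \<open>core_filter\<close> lets the core be
  computed on this shorter list.\<close>

lemma memory_core_alg:
  assumes "distinct xs"
  shows "memory (core_alg m ks K \<Gamma>) d g xs = filter (\<lambda>x. x \<in> core d g m K \<Gamma> xs) xs"
  using assms
proof (induction xs rule: rev_induct)
  case Nil
  then show ?case by (simp add: memory_def)
next
  case (snoc p xs)
  let ?c = "core d g m K \<Gamma>"
  define S where "S = insert p (?c xs)"
  have p: "p \<notin> set xs" using snoc.prems by simp
  have mem: "filter (\<lambda>x. x \<in> ?c xs) xs @ [p] = filter (\<lambda>x. x \<in> S) (xs @ [p])"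
    using p by (auto simp: S_def intro: filter_cong)
  have sub: "?c (xs @ [p]) \<subseteq> S"
    unfolding S_def by (rule core_snoc_subset)
  have "memory (core_alg m ks K \<Gamma>) d g (xs @ [p]) =
      step (core_alg m ks K \<Gamma>) d g (filter (\<lambda>x. x \<in> ?c xs) xs) p"
    using snoc by (simp add: memory_def)
  also have "\<dots> = filter (\<lambda>x. x \<in> ?c (filter (\<lambda>x. x \<in> S) (xs @ [p])))
      (filter (\<lambda>x. x \<in> S) (xs @ [p]))"
    unfolding mem[symmetric] using snoc.prems by (intro step_core_alg) auto
  also have "\<dots> = filter (\<lambda>x. x \<in> ?c (xs @ [p])) (xs @ [p])"
    unfolding core_filter[OF sub] filter_filter using sub by (intro filter_cong) auto
  finally show ?case .
qed

lemma space_used_core_alg: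
  assumes "distinct xs" "finite \<Gamma>"
  shows "space_used (core_alg m ks K \<Gamma>) d g xs \<le> card \<Gamma> * (m * K)"
proof -
  have "length (memory (core_alg m ks K \<Gamma>) d g (take t xs)) \<le> card \<Gamma> * (m * K)" for t
  proof -
    let ?C = "core d g m K \<Gamma> (take t xs)"
    have "length (memory (core_alg m ks K \<Gamma>) d g (take t xs))
        = card (set (filter (\<lambda>x. x \<in> ?C) (take t xs)))"
      unfolding memory_core_alg[OF distinct_take[OF assms(1)]]
      using assms(1) by (simp only: distinct_card distinct_filter distinct_take)
    also have "\<dots> \<le> card ?C"
      by (rule card_mono) (auto intro: finite_subset[OF core_subset])
    also have "\<dots> \<le> card \<Gamma> * (m * K)" by (rule card_core[OF assms(2)])
    finally show ?thesis .
  qed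
  then show ?thesis unfolding space_used_def by (subst Max_le_iff) auto
qed

section \<open>Optimal solutions\<close>

lemma opt_diversity_altdef:
  "opt_diversity X d g m ks = (SUP S \<in> feasible X g m ks. diversity d S)"
  by (simp add: opt_diversity_def feasible_def)

lemma opt_attained:
  assumes "finite X" "feasible X g m ks \<noteq> {}"
  shows "\<exists>S \<in> feasible X g m ks. diversity d S = opt_diversity X d g m ks"
proof -
  have "finite (feasible X g m ks)"
    by (rule finite_subset[of _ "Pow X"]) (use assms in \<open>auto simp: feasible_def\<close>)
  then have "opt_diversity X d g m ks \<in> diversity d ` feasible X g m ks"
    unfolding opt_diversity_altdef using assms(2)
    by (metis Max_Sup Max_in finite_imageI image_is_empty)
  then show ?thesis by auto
qed

lemma opt_solution:
  assumes "finite X" "feasible X g m ks \<noteq> {}"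
  shows "opt_solution X d g m ks \<in> feasible X g m ks"
    and "diversity d (opt_solution X d g m ks) = opt_diversity X d g m ks"
proof -
  have "\<exists>S. S \<in> feasible X g m ks \<and> diversity d S = opt_diversity X d g m ks"
    using opt_attained[OF assms, of d] by blast
  from someI_ex[OF this] show "opt_solution X d g m ks \<in> feasible X g m ks"
    "diversity d (opt_solution X d g m ks) = opt_diversity X d g m ks"
    unfolding opt_solution_def by auto
qed

lemma feasible_nonempty:
  assumes "fmmd_instance X d g m ks"
  shows "feasible X g m ks \<noteq> {}"
proof -
  have "\<forall>i\<in>{1..m}. \<exists>T \<subseteq> group X g i. card T = ks i"
    using assms unfolding fmmd_instance_def by (metis obtain_subset_with_card_n)
  then obtain T where T: "\<And>i. i \<in> {1..m} \<Longrightarrow> T i \<subseteq> group X g i \<and> card (T i) = ks i"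
    by metis
  have "(\<Union>i\<in>{1..m}. T i) \<inter> group X g i = T i" if "i \<in> {1..m}" for i
    using T that unfolding group_def by fastforce
  moreover have "(\<Union>i\<in>{1..m}. T i) \<subseteq> X"
    using T unfolding group_def by blast
  ultimately have "(\<Union>i\<in>{1..m}. T i) \<in> feasible X g m ks"
    using T by (simp add: feasible_def)
  then show ?thesis by blast
qed

lemma card_eq_sum_groups:
  assumes "fmmd_instance X d g m ks" "S \<subseteq> X"
  shows "card S = (\<Sum>i=1..m. card (S \<inter> group X g i))"
proof -
  have "S = (\<Union>i\<in>{1..m}. S \<inter> group X g i)"
    using assms unfolding fmmd_instance_def group_def by blast
  moreover have "card (\<Union>i\<in>{1..m}. S \<inter> group X g i) = (\<Sum>i=1..m. card (S \<inter> group X g i))"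
    using assms unfolding fmmd_instance_def group_def
    by (intro card_UN_disjoint) (auto intro: finite_subset)
  ultimately show ?thesis by simp
qed

text \<open>Together with \<open>diversity_image\<close> this carries solutions between positions in
  the memory and points.\<close>

lemma image_in_feasible_iff:
  assumes "inj_on f J" "S \<subseteq> J"
  shows "f ` S \<in> feasible (f ` J) g m ks \<longleftrightarrow> S \<in> feasible J (g \<circ> f) m ks"
proof -
  have "f ` S \<inter> group (f ` J) g i = f ` (S \<inter> group J (g \<circ> f) i)" for i
    using assms(2) unfolding group_def by auto
  moreover have "inj_on f (S \<inter> group J (g \<circ> f) i)" for i
    using assms by (auto intro: inj_on_subset)
  ultimately show ?thesis
    using assms(2) by (auto simp: feasible_def card_image)
qed

lemma diversity_image:
  assumes "inj_on f S"
  shows "diversity d (f ` S) = diversity (\<lambda>x y. d (f x) (f y)) S"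
proof -
  have "{(u, v). u \<in> f ` S \<and> v \<in> f ` S \<and> u \<noteq> v}
      = map_prod f f ` {(u, v). u \<in> S \<and> v \<in> S \<and> u \<noteq> v}"
    using assms by (auto simp: inj_on_def image_iff)
  then show ?thesis
    unfolding diversity_def by (simp add: image_image case_prod_unfold)
qed

lemma feasible_cong:
  "(\<And>x. x \<in> X \<Longrightarrow> g x = g' x) \<Longrightarrow> feasible X g m ks = feasible X g' m ks"
  unfolding feasible_def group_def by (auto cong: conj_cong)

lemma diversity_cong:
  "(\<And>x y. x \<in> S \<Longrightarrow> y \<in> S \<Longrightarrow> d x y = d' x y) \<Longrightarrow> diversity d S = diversity d' S"
  unfolding diversity_def by (intro INF_cong) auto

text \<open>Since \<open>group\<close> depends on the ground set, changing the ground set requires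
  that \<open>S\<close> meets both versions of each group in the same points.\<close>

lemma feasible_mono:
  assumes "S \<in> feasible Y g m ks" "Y \<subseteq> X"
  shows "S \<in> feasible X g m ks"
proof -
  have "S \<inter> group X g i = S \<inter> group Y g i" for i
    using assms unfolding feasible_def group_def by blast
  then show ?thesis using assms by (auto simp: feasible_def)
qed

lemma feasible_restrict:
  assumes "S \<in> feasible X g m ks" "S \<subseteq> Y" "Y \<subseteq> X"
  shows "S \<in> feasible Y g m ks"
proof -
  have "S \<inter> group X g i = S \<inter> group Y g i" for i
    using assms unfolding feasible_def group_def by blast
  then show ?thesis using assms by (auto simp: feasible_def)
qed

text \<open>The answer is optimal among the exactly fair subsets of the memory, and any feasible
  \<open>S\<close> inside the core competes with it once pulled back to positions.\<close>

lemma result_core_alg: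
  assumes "distinct xs" "S \<in> feasible (set xs) g m ks" "S \<subseteq> core d g m K \<Gamma> xs"
  defines "R \<equiv> result (core_alg m ks K \<Gamma>) d g xs"
  shows "R \<in> feasible (set xs) g m ks" and "diversity d S \<le> diversity d R"
proof -
  define ps where "ps = memory (core_alg m ks K \<Gamma>) d g xs"
  define v where "v = view d g ps"
  define J where "J = {..<length ps}"
  have ps: "ps = filter (\<lambda>x. x \<in> core d g m K \<Gamma> xs) xs"
    unfolding ps_def using assms(1) by (rule memory_core_alg)
  have dist: "distinct ps" using assms(1) by (simp add: ps)
  have set: "set ps = core d g m K \<Gamma> xs" using core_subset by (fastforce simp: ps)
  have inj: "inj_on ((!) ps) J" using dist by (auto simp: J_def inj_on_nth)
  have img: "(!) ps ` J = set ps" by (auto simp: J_def set_conv_nth)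
  have feas: "feasible J (g \<circ> (!) ps) m ks = feasible J (view_group v) m ks"
    by (intro feasible_cong) (simp add: J_def v_def)
  have div: "diversity d ((!) ps ` I) = diversity (view_dist v) I" if "I \<subseteq> J" for I
  proof -
    have "diversity (\<lambda>x y. d (ps ! x) (ps ! y)) I = diversity (view_dist v) I"
    proof (rule diversity_cong)
      show "d (ps ! x) (ps ! y) = view_dist v x y" if "x \<in> I" "y \<in> I" for x y
        using that \<open>I \<subseteq> J\<close> by (metis J_def lessThan_iff subsetD v_def view_dist_view)
    qed
    then show ?thesis
      using diversity_image[OF inj_on_subset[OF inj that], of d] by simp
  qed
  obtain I where I: "I \<subseteq> J" "S = (!) ps ` I"
    using assms(3) unfolding set[symmetric] img[symmetric] by (metis subset_imageE)
  have "S \<in> feasible (set ps) g m ks"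
    unfolding set using assms(2,3) core_subset by (rule feasible_restrict)
  then have I_feas: "I \<in> feasible J (view_group v) m ks"
    using image_in_feasible_iff[OF inj I(1)] by (simp add: I(2) img feas)
  let ?I = "opt_solution J (view_dist v) (view_group v) m ks"
  \<comment> \<open>The pulled-back set \<open>I\<close> also witnesses that some fair subset
    exists, without which the choice in \<open>opt_solution\<close> would be arbitrary.\<close>
  have "finite J" "feasible J (view_group v) m ks \<noteq> {}"
    using I_feas by (auto simp: J_def)
  note opt = opt_solution[OF this, of "view_dist v"]
  then have sub: "?I \<subseteq> J" by (simp add: feasible_def)
  have R: "R = (!) ps ` ?I"
  proof -
    have "R = set (nths ps ?I)"
      by (simp add: R_def result_def ps_def v_def J_def core_alg_def Let_def)
    then show ?thesis using sub by (auto simp: set_nths J_def)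
  qed
  have "R \<in> feasible (set ps) g m ks"
    using image_in_feasible_iff[OF inj sub] opt(1) by (simp add: R img feas)
  then show "R \<in> feasible (set xs) g m ks"
    by (rule feasible_mono) (simp add: set core_subset)
  have "diversity (view_dist v) I \<le> diversity (view_dist v) ?I"
    unfolding opt(2) opt_diversity_altdef using I_feas by (rule SUP_upper)
  then show "diversity d S \<le> diversity d R"
    using I(1) sub by (simp add: R I(2) div)
qed

section \<open>Quality of the coreset\<close>

text \<open>Fills up a partial solution \<open>B\<close>, with the geometry of the space entering
  through the packing bound \<open>ball\<close>. An inclusion-maximal set in \<open>F\<close> takes
  the place of adding points one at a time.\<close>

lemma fair_extension:
  fixes K N :: nat
  assumes inst: "fmmd_instance X d g m ks" and d_sym: "\<And>x y. d x y = d y x"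
    and T: "\<And>i. i \<in> {1..m} \<Longrightarrow> T i \<subseteq> group X g i"
    and B: "B \<subseteq> (\<Union>i\<in>{1..m}. T i)" "separated d r B"
    and le: "\<And>i. i \<in> {1..m} \<Longrightarrow> card (B \<inter> group X g i) \<le> ks i"
    and large: "\<And>i. i \<in> {1..m} \<Longrightarrow> card (B \<inter> group X g i) < ks i \<Longrightarrow> N * (\<Sum>i=1..m. ks i) \<le> card (T i)"
    and ball: "\<And>p i. p \<in> X \<Longrightarrow> i \<in> {1..m} \<Longrightarrow> card {t \<in> T i. d p t < r} \<le> N"
    and "0 < N"
    and d0: "\<And>p. p \<in> X \<Longrightarrow> d p p < r"
  obtains S where "S \<in> feasible X g m ks" "S \<subseteq> (\<Union>i\<in>{1..m}. T i)" "separated d r S"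
proof -
  let ?U = "\<Union>i\<in>{1..m}. T i"
  define F where "F = {S. B \<subseteq> S \<and> S \<subseteq> ?U \<and> separated d r S \<and>
    (\<forall>i\<in>{1..m}. card (S \<inter> group X g i) \<le> ks i)}"
  have U: "?U \<subseteq> X" using T by (fastforce simp: group_def)
  have finX: "finite X" using inst by (simp add: fmmd_instance_def)
  have "finite F"
    by (rule finite_subset[of _ "Pow X"]) (use U finX in \<open>auto simp: F_def\<close>)
  moreover have "B \<in> F" using B le by (auto simp: F_def)
  ultimately obtain S where S: "S \<in> F" and max: "\<And>S'. S' \<in> F \<Longrightarrow> S \<subseteq> S' \<Longrightarrow> S' = S"
    using finite_has_maximal[of F] by (metis empty_iff)
  have SX: "S \<subseteq> X" and finS: "finite S"
    using S U finite_subset[OF _ finX, of S] by (auto simp: F_def)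
  have "card (S \<inter> group X g i) = ks i" if i: "i \<in> {1..m}" for i
  proof (rule ccontr)
    assume "card (S \<inter> group X g i) \<noteq> ks i"
    then have less: "card (S \<inter> group X g i) < ks i" using S i by (force simp: F_def)
    have "card (B \<inter> group X g i) \<le> card (S \<inter> group X g i)"
      using S finS by (intro card_mono) (auto simp: F_def)
    \<comment> \<open>A group short in \<open>S\<close> was already short in \<open>B\<close>, so
      its \<open>T i\<close> is large.\<close>
    then have K: "N * (\<Sum>i=1..m. ks i) \<le> card (T i)" using large i less by simp
    \<comment> \<open>No quota is exceeded and one is missed, so the points of \<open>S\<close>
      exclude strictly fewer points than \<open>T i\<close> has.\<close>
    have "card S < (\<Sum>i=1..m. ks i)"
      unfolding card_eq_sum_groups[OF inst SX]
      using S i less by (intro sum_strict_mono_ex1) (auto simp: F_def)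
    then have "N * card S < card (T i)"
      using \<open>0 < N\<close> K by (metis less_le_trans mult_less_mono2)
    moreover have "card (\<Union>s\<in>S. {t \<in> T i. d s t < r}) \<le> N * card S"
    proof -
      have "card (\<Union>s\<in>S. {t \<in> T i. d s t < r}) \<le> (\<Sum>s\<in>S. card {t \<in> T i. d s t < r})"
        using finS by (rule card_UN_le)
      also have "\<dots> \<le> card S * N"
        using sum_bounded_above[of S "\<lambda>s. card {t \<in> T i. d s t < r}" N] ball[OF _ i] SX by auto
      finally show ?thesis by (simp add: mult.commute)
    qed
    moreover have "finite (\<Union>s\<in>S. {t \<in> T i. d s t < r})"
      using finS finite_subset[OF T[OF i]] finX by (auto simp: group_def)
    ultimately have "\<not> T i \<subseteq> (\<Union>s\<in>S. {t \<in> T i. d s t < r})"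
      using card_mono by (meson leD le_trans not_le_imp_less)
    then obtain t where t: "t \<in> T i" "\<And>s. s \<in> S \<Longrightarrow> r \<le> d s t"
      by (fastforce simp: not_le)
    have tX: "t \<in> X" "g t = i" using T[OF i] t(1) by (auto simp: group_def)
    \<comment> \<open>Membership in \<open>S\<close> would force \<open>r \<le> d t t\<close>,
      against \<open>d0\<close>.\<close>
    have tS: "t \<notin> S" using t(2)[of t] d0[OF tX(1)] by auto
    have grp: "insert t S \<inter> group X g i' =
        (if i' = i then insert t (S \<inter> group X g i') else S \<inter> group X g i')" for i'
      using tX by (auto simp: group_def)
    have "insert t S \<in> F"
      using S t i less tS finS d_sym unfolding F_def
      by (auto simp: grp separated_def card_insert_if)
    then have "insert t S = S" by (intro max) auto
    then show False using tS by blast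
  qed
  then have "S \<in> feasible X g m ks" using SX by (simp add: feasible_def)
  then show thesis using S that by (auto simp: F_def)
qed

text \<open>\<open>W\<close> is the part of the optimal solution in groups below the cap, and
  \<open>f\<close> moves it into the greedy sets. The image of \<open>W\<close> is the starting set
  for \<open>fair_extension\<close>.\<close>

lemma coreset_contains_solution:
  fixes m K N :: nat and ks :: "nat \<Rightarrow> nat"
  defines "k \<equiv> \<Sum>i=1..m. ks i"
  assumes inst: "fmmd_instance X d g m ks" and xs: "set xs = X"
    and opt: "Sopt \<in> feasible X g m ks" "separated d L Sopt"
    and r: "0 < r" "r + 2 * \<gamma> \<le> L" and "0 < \<gamma>" "\<gamma> \<in> \<Gamma>"
    and N: "0 < N" "\<And>p T. p \<in> X \<Longrightarrow> T \<subseteq> X \<Longrightarrow> separated d \<gamma> T \<Longrightarrow> card {t \<in> T. d p t < r} \<le> N"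
  obtains S where "S \<in> feasible X g m ks" "S \<subseteq> core d g m (N * k) \<Gamma> xs" "separated d r S"
proof -
  interpret Metric_space X d using inst by (simp add: fmmd_instance_def)
  have finX: "finite X" using inst by (simp add: fmmd_instance_def)
  define T where "T i = greedy d g \<gamma> i (N * k) xs" for i
  have T_group: "T i \<subseteq> group X g i" for i
    unfolding T_def group_def using greedy_subset xs by fast
  have T_sep: "separated d \<gamma> (T i)" for i
    unfolding T_def by (rule separated_greedy[OF commute])
  have T_core: "(\<Union>i\<in>{1..m}. T i) \<subseteq> core d g m (N * k) \<Gamma> xs"
    using \<open>\<gamma> \<in> \<Gamma>\<close> unfolding core_def T_def by blast
  have optX: "Sopt \<subseteq> X" using opt(1) by (simp add: feasible_def)
  define small where "small i \<longleftrightarrow> i \<in> {1..m} \<and> card (T i) < N * k" for i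
  define W where "W = {x \<in> Sopt. small (g x)}"
  have "\<exists>q \<in> T (g x). d x q < \<gamma>" if "x \<in> W" for x
    unfolding T_def
    by (rule greedy_maximal) (use that optX xs \<open>0 < \<gamma>\<close> in \<open>auto simp: W_def small_def T_def\<close>)
  then obtain f where f: "\<And>x. x \<in> W \<Longrightarrow> f x \<in> T (g x)" "\<And>x. x \<in> W \<Longrightarrow> d x (f x) < \<gamma>"
    by metis
  have fX: "f x \<in> X" "g (f x) = g x" if "x \<in> W" for x
    using f(1)[OF that] T_group by (auto simp: group_def)
  have WX: "W \<subseteq> X" using optX by (auto simp: W_def)
  \<comment> \<open>Each endpoint moves by less than \<gamma>, so at least
    \<open>L - 2 * \<gamma>\<close> of the distance survives.\<close>
  have far: "r \<le> d (f x) (f y)" if xy: "x \<in> W" "y \<in> W" "x \<noteq> y" for x y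
  proof -
    have "L \<le> d x y" using opt(2) xy by (auto simp: separated_def W_def)
    moreover have "d x y \<le> d x (f x) + d (f x) y" "d (f x) y \<le> d (f x) (f y) + d (f y) y"
      using triangle xy WX fX by blast+
    ultimately show ?thesis
      using f(2)[OF xy(1)] f(2)[OF xy(2)] r(2) commute[of "f y" y] by linarith
  qed
  have inj: "inj_on f W"
  proof (rule inj_onI, rule ccontr)
    fix x y assume "x \<in> W" "y \<in> W" "f x = f y" "x \<noteq> y"
    then show False using far[of x y] fX[of y] r(1) by simp
  qed
  \<comment> \<open>\<open>f\<close> is injective and preserves groups: small groups are already
    complete, the others still empty, so only groups at the cap can be short.\<close>
  have card_W: "card (f ` W \<inter> group X g i) = (if small i then ks i else 0)" if i: "i \<in> {1..m}" for i
  proof -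
    have "f ` W \<inter> group X g i = f ` {x \<in> W. g x = i}"
      using fX by (auto simp: group_def)
    then have "card (f ` W \<inter> group X g i) = card {x \<in> W. g x = i}"
      using card_image[OF inj_on_subset[OF inj]] by (metis (no_types, lifting) mem_Collect_eq subsetI)
    also have "{x \<in> W. g x = i} = (if small i then Sopt \<inter> group X g i else {})"
      using optX by (auto simp: W_def group_def)
    finally show ?thesis using opt(1) i by (simp add: feasible_def)
  qed
  show thesis
  proof (rule fair_extension[where B = "f ` W" and T = T, OF inst commute T_group])
    show "f ` W \<subseteq> (\<Union>i\<in>{1..m}. T i)"
      using f(1) by (auto simp: W_def small_def)
    show "separated d r (f ` W)" using far by (auto simp: separated_def)
    show "card (f ` W \<inter> group X g i) \<le> ks i" if "i \<in> {1..m}" for i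
      using card_W[OF that] by simp
    show "N * (\<Sum>i=1..m. ks i) \<le> card (T i)"
      if "i \<in> {1..m}" "card (f ` W \<inter> group X g i) < ks i" for i
      using that card_W[OF that(1)] by (auto simp: small_def k_def split: if_splits)
    show "card {t \<in> T i. d p t < r} \<le> N" if "p \<in> X" for p i
      using N(2)[OF that _ T_sep] T_group by (auto simp: group_def)
    show "d p p < r" if "p \<in> X" for p using that r(1) by simp
  next
    fix S assume "S \<in> feasible X g m ks" "S \<subseteq> (\<Union>i\<in>{1..m}. T i)" "separated d r S"
    then show thesis using that[of S] T_core by blast
  qed (use N(1) in auto)
qed

section \<open>Geometric scales for guessing the optimum\<close>

definition scales :: "real \<Rightarrow> real \<Rightarrow> real \<Rightarrow> real set" where
  "scales a lo hi = (\<lambda>j. a * lo * 2 ^ j) ` {..nat \<lfloor>log 2 (hi / lo)\<rfloor>}"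

lemma finite_scales [simp]: "finite (scales a lo hi)"
  by (simp add: scales_def)

text \<open>Rounding \<open>L / lo\<close> down to a power of two loses less than a factor 2, and
  \<open>L \<le> hi\<close> keeps the exponent in range.\<close>

lemma scale_exists:
  assumes "0 < a" "0 < lo" "lo \<le> L" "L \<le> hi"
  obtains \<gamma> where "\<gamma> \<in> scales a lo hi" "a * L / 2 < \<gamma>" "\<gamma> \<le> a * L"
proof -
  define j where "j = nat \<lfloor>log 2 (L / lo)\<rfloor>"
  have L: "0 < L" using assms by simp
  have log: "0 \<le> log 2 (L / lo)" using assms L by (simp add: zero_le_log_cancel_iff)
  then have j: "real j \<le> log 2 (L / lo)" "log 2 (L / lo) < real j + 1"
    unfolding j_def by linarith+
  have "2 powr real j \<le> L / lo" "L / lo < 2 powr (real j + 1)"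
    using j assms L by (simp_all add: le_log_iff log_less_iff)
  then have "2 ^ j * lo \<le> L" "L < 2 * 2 ^ j * lo"
    using assms by (simp_all add: powr_add powr_realpow field_simps)
  then have "a * (2 ^ j * lo) \<le> a * L" "a * L < a * (2 * 2 ^ j * lo)"
    using assms(1) by (auto intro: mult_left_mono mult_strict_left_mono)
  then have "a * L / 2 < a * lo * 2 ^ j" "a * lo * 2 ^ j \<le> a * L"
    by (simp_all add: algebra_simps)
  moreover have "log 2 (L / lo) \<le> log 2 (hi / lo)"
    using assms L by (simp add: divide_right_mono)
  then have "j \<le> nat \<lfloor>log 2 (hi / lo)\<rfloor>"
    unfolding j_def by (intro nat_mono floor_mono)
  then have "a * lo * 2 ^ j \<in> scales a lo hi" by (auto simp: scales_def)
  ultimately show thesis using that by blast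
qed

text \<open>There are at most \<open>log 2 (hi / lo) + 1\<close> scales. The logarithm is at most
  \<open>c * log 2 n\<close>, and the extra 1 is absorbed by \<open>log 2 n\<close>, which is at
  least 1 as \<open>n \<ge> 2\<close>; hence the factor \<open>c + 1\<close>.\<close>

lemma card_scales:
  assumes "0 < lo" "lo \<le> hi" "hi / lo \<le> real n ^ c" "2 \<le> n"
  shows "real (card (scales a lo hi)) \<le> (real c + 1) / ln 2 * ln (real n)"
proof -
  have ratio: "1 \<le> hi / lo" using assms by simp
  have "card (scales a lo hi) \<le> nat \<lfloor>log 2 (hi / lo)\<rfloor> + 1"
    unfolding scales_def by (rule order_trans[OF card_image_le]) auto
  then have "real (card (scales a lo hi)) \<le> real (nat \<lfloor>log 2 (hi / lo)\<rfloor>) + 1"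
    by linarith
  also have "\<dots> \<le> log 2 (hi / lo) + 1"
    using ratio by (simp add: zero_le_log_cancel_iff)
  also have "\<dots> \<le> log 2 (real n ^ c) + log 2 (real n)"
  proof (rule add_mono)
    show "log 2 (hi / lo) \<le> log 2 (real n ^ c)"
      using assms ratio by (intro log_mono) auto
    show "1 \<le> log 2 (real n)" using assms(4) by (simp add: le_log_iff)
  qed
  also have "\<dots> = (real c + 1) / ln 2 * ln (real n)"
    using assms(4) by (simp add: log_nat_power log_def ln_realpow field_simps)
  finally show ?thesis .
qed

section \<open>Guarantees of the algorithm under an abstract packing bound\<close>

lemma stream_lo_le_hi:
  assumes "stream_of_instance xs X d g m ks lo hi c"
  shows "lo \<le> hi"
proof -
  obtain u v where "u \<in> X" "v \<in> X" "u \<noteq> v"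
    using assms unfolding stream_of_instance_def by (metis card_le_Suc0_iff_eq card.infinite
        not_less_eq_eq numeral_2_eq_2 zero_le)
  then show ?thesis using assms unfolding stream_of_instance_def by (meson order_trans)
qed

text \<open>Common to both metric settings: \<open>a\<close> relates the scale to the optimum. With
  \<open>r = L / \<alpha>\<close> and \<open>\<gamma> \<le> a * L\<close>, the assumption on
  \<open>1 / \<alpha> + 2 * a\<close> yields the budget
  \<open>r + 2 * \<gamma> \<le> L\<close>.\<close>

lemma approx_core_alg:
  fixes m N :: nat and ks :: "nat \<Rightarrow> nat"
  assumes stream: "stream_of_instance xs X d g m ks lo hi c"
    and "0 < a" "0 < \<alpha>" and a: "1 / \<alpha> + 2 * a \<le> 1" and "0 \<le> \<epsilon>"
    and N: "0 < N" "\<And>p T L \<gamma>. p \<in> X \<Longrightarrow> T \<subseteq> X \<Longrightarrow> separated d \<gamma> T \<Longrightarrow> 0 < L \<Longrightarrow> a * L / 2 < \<gamma> \<Longrightarrow>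
      \<gamma> \<le> a * L \<Longrightarrow> card {t \<in> T. d p t < L / \<alpha>} \<le> N"
  shows "approx_fair_solution X d g m ks \<alpha> \<epsilon>
    (result (core_alg m ks (N * (\<Sum>i=1..m. ks i)) (scales a lo hi)) d g xs)"
proof -
  define k where "k = (\<Sum>i=1..m. ks i)"
  define R where "R = result (core_alg m ks (N * k) (scales a lo hi)) d g xs"
  have inst: "fmmd_instance X d g m ks" and xs: "distinct xs" "set xs = X" and "0 < lo"
    and bounds: "\<And>u v. u \<in> X \<Longrightarrow> v \<in> X \<Longrightarrow> u \<noteq> v \<Longrightarrow> lo \<le> d u v \<and> d u v \<le> hi"
    using stream by (auto simp: stream_of_instance_def)
  have finX: "finite X" using inst by (simp add: fmmd_instance_def)
  note lo_hi = stream_lo_le_hi[OF stream]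
  obtain Sopt where Sopt: "Sopt \<in> feasible X g m ks" "diversity d Sopt = opt_diversity X d g m ks"
    using opt_attained[OF finX feasible_nonempty[OF inst]] by blast
  \<comment> \<open>\<open>L\<close> is a real parameter here rather than the optimum itself, which
    may be \<infinity>.\<close>
  have key: "R \<in> feasible X g m ks \<and> ereal (L / \<alpha>) \<le> diversity d R"
    if L: "lo \<le> L" "L \<le> hi" "separated d L Sopt" for L
  proof -
    obtain \<gamma> where \<gamma>: "\<gamma> \<in> scales a lo hi" "a * L / 2 < \<gamma>" "\<gamma> \<le> a * L"
      using scale_exists \<open>0 < a\<close> \<open>0 < lo\<close> L by blast
    have "0 < L" using L \<open>0 < lo\<close> by simp
    then have "0 < a * L" using \<open>0 < a\<close> by simp
    then have "0 < \<gamma>" using \<gamma>(2) by linarith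
    have "L / \<alpha> + 2 * \<gamma> \<le> L / \<alpha> + 2 * (a * L)" using \<gamma>(3) by simp
    also have "\<dots> = (1 / \<alpha> + 2 * a) * L" by (simp add: algebra_simps)
    also have "\<dots> \<le> 1 * L" using a \<open>0 < L\<close> by (intro mult_right_mono) auto
    finally have "L / \<alpha> + 2 * \<gamma> \<le> L" by simp
    moreover have "0 < L / \<alpha>" using \<open>0 < L\<close> \<open>0 < \<alpha>\<close> by simp
    ultimately obtain S where S: "S \<in> feasible X g m ks" "separated d (L / \<alpha>) S"
      "S \<subseteq> core d g m (N * k) (scales a lo hi) xs"
      using coreset_contains_solution[OF inst xs(2) Sopt(1) L(3) _ _ \<open>0 < \<gamma>\<close> \<gamma>(1) N(1),
          of "L / \<alpha>", OF _ _ N(2)[OF _ _ _ \<open>0 < L\<close> \<gamma>(2,3)], folded k_def]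
      by blast
    have "ereal (L / \<alpha>) \<le> diversity d S" using S(2) by (simp add: le_diversity_iff)
    then show ?thesis
      using result_core_alg[OF xs(1) S(1,3)[folded xs(2)]] xs(2)
      unfolding R_def by (metis order_trans)
  qed
  have main: "R \<in> feasible X g m ks \<and> opt_diversity X d g m ks / ereal \<alpha> \<le> diversity d R"
  proof (cases "k \<le> 1")
    case True
    \<comment> \<open>The diversity of a feasible set is then \<open>\<infinity>\<close>, so that any \<open>L\<close> will do.\<close>
    have at_most_one: "u = v" if "S \<in> feasible X g m ks" "u \<in> S" "v \<in> S" for S u v
    proof -
      have "S \<subseteq> X" using that(1) by (simp add: feasible_def)
      moreover from this have "card S = k"
        using that(1) card_eq_sum_groups[OF inst] by (simp add: feasible_def k_def)
      ultimately show ?thesis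
        using True that(2,3) finite_subset[OF _ finX] by (metis One_nat_def card_le_Suc0_iff_eq)
    qed
    have "separated d lo Sopt" using at_most_one[OF Sopt(1)] unfolding separated_def by blast
    then have R: "R \<in> feasible X g m ks" using key lo_hi by blast
    then have none: "{(u, v). u \<in> R \<and> v \<in> R \<and> u \<noteq> v} = {}" using at_most_one by blast
    then have "diversity d R = \<infinity>" unfolding diversity_def none by (simp add: top_ereal_def)
    then show ?thesis using R by simp
  next
    case False
    \<comment> \<open>With at least two points the infimum runs over a finite nonempty set of pairs.
      It is attained, and the distance of a closest pair lies between \<open>lo\<close> and
      \<open>hi\<close> and serves as \<open>L\<close>.\<close>
    let ?P = "{(u, v). u \<in> Sopt \<and> v \<in> Sopt \<and> u \<noteq> v}"
    have sub: "Sopt \<subseteq> X" using Sopt(1) by (simp add: feasible_def)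
    then have "card Sopt = k"
      using Sopt(1) card_eq_sum_groups[OF inst] by (simp add: feasible_def k_def)
    then have "?P \<noteq> {}"
      using False card_le_Suc0_iff_eq[OF finite_subset[OF sub finX]] by auto
    moreover have "finite ?P"
      by (rule finite_subset[of _ "X \<times> X"]) (use sub finX in auto)
    ultimately have "diversity d Sopt \<in> (\<lambda>(u, v). ereal (d u v)) ` ?P"
      unfolding diversity_def by (metis (no_types, lifting) Min_Inf Min_in finite_imageI image_is_empty)
    then obtain u v where uv: "u \<in> Sopt" "v \<in> Sopt" "u \<noteq> v" "diversity d Sopt = ereal (d u v)"
      by auto
    have "separated d (d u v) Sopt" using uv(4) by (simp flip: le_diversity_iff)
    then show ?thesis
      using key[of "d u v"] bounds[of u v] uv sub \<open>0 < \<alpha>\<close> by (auto simp flip: Sopt(2))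
  qed
  have "(1 - \<epsilon>) * real (ks i) \<le> real (ks i)" for i
    using \<open>0 \<le> \<epsilon>\<close> mult_right_mono[of "1 - \<epsilon>" 1 "real (ks i)"] by simp
  then show ?thesis
    using main unfolding approx_fair_solution_def R_def k_def feasible_def by auto
qed

lemma space_core_alg:
  fixes m N :: nat and ks :: "nat \<Rightarrow> nat"
  assumes "stream_of_instance xs X d g m ks lo hi c" "real N \<le> B"
  defines "k \<equiv> \<Sum>i=1..m. ks i"
  shows "real (space_used (core_alg m ks (N * k) (scales a lo hi)) d g xs)
    \<le> (real c + 1) / ln 2 * (B * real k * real m * ln (real (card X)))"
proof -
  have stream: "distinct xs" "0 < lo" "hi / lo \<le> real (card X) ^ c" "2 \<le> card X"
    using assms(1) by (auto simp: stream_of_instance_def)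
  have "real (space_used (core_alg m ks (N * k) (scales a lo hi)) d g xs)
      \<le> real (card (scales a lo hi)) * (real m * (real N * real k))"
    using of_nat_mono[OF space_used_core_alg[OF stream(1) finite_scales], where 'a = real]
    by (metis of_nat_mult)
  also have "\<dots> \<le> ((real c + 1) / ln 2 * ln (real (card X))) * (real m * (B * real k))"
    using card_scales[OF stream(2) stream_lo_le_hi[OF assms(1)] stream(3,4)] stream(4) assms(2)
    by (intro mult_mono) auto
  finally show ?thesis by (simp add: ac_simps)
qed

section \<open>Packing in doubling spaces, and the two choices of parameters\<close>

lemma separated_ball_card_doubling:
  assumes "Metric_space X d" "finite X" "p \<in> X" "T \<subseteq> X" "separated d \<gamma> T"
    and "0 < \<gamma>" "\<gamma> \<le> r"
  shows "real (card {t \<in> T. d p t < r}) \<le> (2 * r / \<gamma>) ^ doubling_dim X d"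
proof -
  interpret Metric_space X d by fact
  \<comment> \<open>Covering balls of radius \<open>\<gamma> / 2\<close> contain at most one point
    of \<open>T\<close> each, and \<open>\<gamma> \<le> r\<close> is what the restriction to
    \<open>r' \<le> r / 2\<close> in \<open>doubling_bound\<close> demands.\<close>
  have "0 < \<gamma> / 2 \<and> \<gamma> / 2 \<le> r / 2" using assms by simp
  then obtain Q where Q: "Q \<subseteq> X" "finite Q" "real (card Q) \<le> (r / (\<gamma> / 2)) ^ doubling_dim X d"
    "mball p r \<subseteq> (\<Union>q\<in>Q. mball q (\<gamma> / 2))"
    using doubling_bound_doubling_dim[OF assms(1,2)] \<open>p \<in> X\<close> unfolding doubling_bound_def by meson
  have "{t \<in> T. d p t < r} \<subseteq> (\<Union>q\<in>Q. {t \<in> T. d q t < \<gamma> / 2})"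
  proof
    fix t assume t: "t \<in> {t \<in> T. d p t < r}"
    then have "t \<in> mball p r" using assms(3,4) by auto
    then obtain q where "q \<in> Q" "t \<in> mball q (\<gamma> / 2)" using Q(4) by blast
    then show "t \<in> (\<Union>q\<in>Q. {t \<in> T. d q t < \<gamma> / 2})" using t by auto
  qed
  moreover have "finite (\<Union>q\<in>Q. {t \<in> T. d q t < \<gamma> / 2})"
    using Q(2) finite_subset[OF assms(4,2)] by auto
  ultimately have "card {t \<in> T. d p t < r} \<le> card (\<Union>q\<in>Q. {t \<in> T. d q t < \<gamma> / 2})"
    by (rule card_mono[rotated])
  also have "\<dots> \<le> (\<Sum>q\<in>Q. card {t \<in> T. d q t < \<gamma> / 2})"
    by (rule card_UN_le[OF Q(2)])
  also have "\<dots> \<le> (\<Sum>q\<in>Q. 1)"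
    using Q(1) assms by (intro sum_mono separated_ball_card_le_1[of X]) auto
  finally have "real (card {t \<in> T. d p t < r}) \<le> real (card Q)" by simp
  then show ?thesis using Q(3) by (simp add: mult.commute)
qed

text \<open>Here \<open>N = 1\<close> and \<open>a = 1 / 4\<close>; the factor \<open>1 *\<close>
  keeps the shape \<open>N * k\<close>. The scale exceeds \<open>L / 8\<close>, so the target
  radius, at most \<open>L / 30\<close>, is below \<open>\<gamma> / 2\<close>.\<close>

lemma general_metric_alg:
  assumes stream: "stream_of_instance xs X d g m ks lo hi c" and \<epsilon>: "0 < \<epsilon>" "\<epsilon> < 1"
  defines "A \<equiv> core_alg m ks (1 * (\<Sum>i=1..m. ks i)) (scales (1 / 4) lo hi)"
  shows "real (space_used A d g xs)
      \<le> (real c + 1) / ln 2 * ((1 / \<epsilon>) * real (\<Sum>i=1..m. ks i) * real m * ln (real (card X)))"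
    and "approx_fair_solution X d g m ks (30 * (1 + \<epsilon>)) \<epsilon> (result A d g xs)"
proof -
  have MX: "Metric_space X d"
    using stream by (simp add: stream_of_instance_def fmmd_instance_def)
  have finX: "finite X"
    using stream by (simp add: stream_of_instance_def fmmd_instance_def)
  show "real (space_used A d g xs)
      \<le> (real c + 1) / ln 2 * ((1 / \<epsilon>) * real (\<Sum>i=1..m. ks i) * real m * ln (real (card X)))"
    unfolding A_def by (rule space_core_alg[OF stream]) (use \<epsilon> in simp)
  show "approx_fair_solution X d g m ks (30 * (1 + \<epsilon>)) \<epsilon> (result A d g xs)"
    unfolding A_def
  proof (rule approx_core_alg[OF stream])
    have "1 / (30 * (1 + \<epsilon>)) \<le> 1 / 2" using \<epsilon> by (intro divide_left_mono) auto
    then show "1 / (30 * (1 + \<epsilon>)) + 2 * (1 / 4) \<le> 1" by simp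
    show "card {t \<in> T. d p t < L / (30 * (1 + \<epsilon>))} \<le> 1"
      if "p \<in> X" "T \<subseteq> X" "separated d \<gamma> T" "0 < L" "1 / 4 * L / 2 < \<gamma>" for p T L \<gamma>
    proof -
      define r where "r = L / (30 * (1 + \<epsilon>))"
      have "r \<le> L / 30" unfolding r_def using \<epsilon> that(4) by (intro divide_left_mono) auto
      also have "\<dots> \<le> \<gamma> / 2" using that by simp
      finally have "card {t \<in> T. d p t < r} \<le> card {t \<in> T. d p t < \<gamma> / 2}"
        using finite_subset[OF that(2) finX] by (intro card_mono) auto
      then show ?thesis
        using separated_ball_card_le_1[OF MX that(1-3)] unfolding r_def by linarith
    qed
  qed (use \<epsilon> in auto)
qed

text \<open>This \<open>a\<close> exhausts the budget:
  \<open>1 / (1 + \<epsilon>) + 2 * a = 1\<close>. For \<open>r = L / (1 + \<epsilon>)\<close> the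
  scale lies above \<open>\<epsilon> * r / 4\<close>, so \<open>2 * r / \<gamma>\<close> is below
  \<open>8 / \<epsilon>\<close>; cardinalities being integers, \<open>N\<close> may be the floor of
  the resulting power.\<close>

lemma doubling_metric_alg:
  assumes stream: "stream_of_instance xs X d g m ks lo hi c" and \<epsilon>: "0 < \<epsilon>" "\<epsilon> < 1"
  defines "l \<equiv> doubling_dim X d"
  defines "A \<equiv> core_alg m ks (nat \<lfloor>(8 / \<epsilon>) ^ l\<rfloor> * (\<Sum>i=1..m. ks i))
    (scales (\<epsilon> / (2 * (1 + \<epsilon>))) lo hi)"
  shows "real (space_used A d g xs) \<le> (real c + 1) / ln 2 *
      ((8 / \<epsilon>) ^ l * real (\<Sum>i=1..m. ks i) * real m * (1 / \<epsilon>) * ln (real (card X)))"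
    and "approx_fair_solution X d g m ks (1 + \<epsilon>) \<epsilon> (result A d g xs)"
proof -
  let ?N = "nat \<lfloor>(8 / \<epsilon>) ^ l\<rfloor>"
  have MX: "Metric_space X d" and finX: "finite X"
    using stream by (simp_all add: stream_of_instance_def fmmd_instance_def)
  have "1 \<le> (8 / \<epsilon>) ^ l" using \<epsilon> by (intro one_le_power) simp
  then have N: "0 < ?N" "real ?N \<le> (8 / \<epsilon>) ^ l" by linarith+
  \<comment> \<open>The claimed bound carries a further factor \<open>1 / \<epsilon>\<close>, which
    is at least 1.\<close>
  have "(8 / \<epsilon>) ^ l \<le> (8 / \<epsilon>) ^ l * (1 / \<epsilon>)"
    using \<epsilon> mult_left_mono[of 1 "1 / \<epsilon>" "(8 / \<epsilon>) ^ l"] by simp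
  with N(2) have "real ?N \<le> (8 / \<epsilon>) ^ l * (1 / \<epsilon>)" by simp
  from space_core_alg[OF stream this]
  show "real (space_used A d g xs) \<le> (real c + 1) / ln 2 *
      ((8 / \<epsilon>) ^ l * real (\<Sum>i=1..m. ks i) * real m * (1 / \<epsilon>) * ln (real (card X)))"
    unfolding A_def by (simp only: ac_simps)
  show "approx_fair_solution X d g m ks (1 + \<epsilon>) \<epsilon> (result A d g xs)"
    unfolding A_def
  proof (rule approx_core_alg[OF stream])
    show "1 / (1 + \<epsilon>) + 2 * (\<epsilon> / (2 * (1 + \<epsilon>))) \<le> 1" using \<epsilon> by (simp add: field_simps)
    show "card {t \<in> T. d p t < L / (1 + \<epsilon>)} \<le> ?N"
      if "p \<in> X" "T \<subseteq> X" "separated d \<gamma> T" "0 < L" and \<gamma>: "\<epsilon> / (2 * (1 + \<epsilon>)) * L / 2 < \<gamma>"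
        "\<gamma> \<le> \<epsilon> / (2 * (1 + \<epsilon>)) * L" for p T L \<gamma>
    proof -
      define r where "r = L / (1 + \<epsilon>)"
      have "0 < r" using that(4) \<epsilon> by (simp add: r_def)
      have r: "\<epsilon> * r < 4 * \<gamma>" "2 * \<gamma> \<le> \<epsilon> * r"
        using \<gamma> \<epsilon> by (simp_all add: r_def field_simps)
      have "0 < \<epsilon> * r" using \<open>0 < r\<close> \<epsilon> by simp
      then have "0 < \<gamma>" using r(1) by linarith
      have "\<epsilon> * r \<le> 1 * r" using \<epsilon> \<open>0 < r\<close> by (intro mult_right_mono) auto
      then have "\<gamma> \<le> r" using r(2) \<open>0 < \<gamma>\<close> by linarith
      then have "real (card {t \<in> T. d p t < r}) \<le> (2 * r / \<gamma>) ^ l"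
        unfolding l_def
        by (rule separated_ball_card_doubling[OF MX finX that(1-3) \<open>0 < \<gamma>\<close>])
      also have "\<dots> \<le> (8 / \<epsilon>) ^ l"
        using r(1) \<open>0 < r\<close> \<open>0 < \<gamma>\<close> \<epsilon> by (intro power_mono) (auto simp: field_simps)
      finally show ?thesis unfolding r_def by (simp add: le_nat_floor)
    qed
  qed (use \<epsilon> N in auto)
qed

theorem corollary1:
  shows
    "(\<exists>A :: real \<Rightarrow> nat \<Rightarrow> (nat \<Rightarrow> nat) \<Rightarrow> real \<Rightarrow> real \<Rightarrow> stream_alg.
        \<forall>c. \<exists>C :: real. \<forall>\<epsilon> m ks lo hi (X :: 'a set) d g xs.
          0 < \<epsilon> \<and> \<epsilon> < 1 \<and> stream_of_instance xs X d g m ks lo hi c \<longrightarrow>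
            real (space_used (A \<epsilon> m ks lo hi) d g xs)
              \<le> C * ((1 / \<epsilon>) * real (\<Sum>i=1..m. ks i) * real m * ln (real (card X))) \<and>
            approx_fair_solution X d g m ks (30 * (1 + \<epsilon>)) \<epsilon> (result (A \<epsilon> m ks lo hi) d g xs))
     \<and>
     (\<exists>A :: real \<Rightarrow> nat \<Rightarrow> (nat \<Rightarrow> nat) \<Rightarrow> real \<Rightarrow> real \<Rightarrow> nat \<Rightarrow> stream_alg.
        \<forall>c. \<exists>C :: real. \<forall>\<epsilon> m ks lo hi D X d g xs dim.
          0 < \<epsilon> \<and> \<epsilon> < 1 \<and> X \<subseteq> topspace (Euclidean_space D) \<and> d = euclid_dist D \<and>
          stream_of_instance xs X d g m ks lo hi c \<and> dim = doubling_dim X d \<longrightarrow>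
            real (space_used (A \<epsilon> m ks lo hi dim) d g xs)
              \<le> C * ((8 / \<epsilon>) ^ dim * real (\<Sum>i=1..m. ks i) * real m * (1 / \<epsilon>) * ln (real (card X))) \<and>
            approx_fair_solution X d g m ks (1 + \<epsilon>) \<epsilon> (result (A \<epsilon> m ks lo hi dim) d g xs))"
  (is "(\<exists>A. \<forall>c. ?P A c) \<and> (\<exists>A. \<forall>c. ?Q A c)")
proof
  show "\<exists>A. \<forall>c. ?P A c"
  proof (rule exI, rule allI)
    \<comment> \<open>The algorithm is told neither \<open>c\<close> nor the number of points: its
      scales come from \<open>lo\<close> and \<open>hi\<close>, and \<open>c\<close> enters only the
      constant.\<close>
    show "?P (\<lambda>\<epsilon> m ks lo hi. core_alg m ks (1 * (\<Sum>i=1..m. ks i)) (scales (1 / 4) lo hi)) c" for c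
      by (intro exI[of _ "(real c + 1) / ln 2"]) (use general_metric_alg in blast)
  qed
  show "\<exists>A. \<forall>c. ?Q A c"
  proof (rule exI, rule allI)
    \<comment> \<open>The doubling dimension is passed to the algorithm as \<open>l\<close> because
      it determines the cap.\<close>
    show "?Q (\<lambda>\<epsilon> m ks lo hi l. core_alg m ks (nat \<lfloor>(8 / \<epsilon>) ^ l\<rfloor> * (\<Sum>i=1..m. ks i))
        (scales (\<epsilon> / (2 * (1 + \<epsilon>))) lo hi)) c" for c
      by (intro exI[of _ "(real c + 1) / ln 2"]) (intro allI impI, elim conjE, hypsubst,
          rule conjI; rule doubling_metric_alg; assumption)
  qed
qed

end
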